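(* Let $-1\le\alpha<0$ and $n\ge 4$. Among all connected unicyclic graphs on $n$ vertices, the cycle $C_n$ is the unique graph with maximum general sum-connectivity index $\chi_\alpha$, which equals $n4^\alpha$. For $n=4$, the graph $U_{4,3}$ (a triangle with one pendant vertex attached) is the unique graph with the second largest value of $\chi_\alpha$, equal to $2\cdot 4^\alpha+2\cdot 5^\alpha$. For $n\ge 5$, the graphs with the second largest value of $\chi_\alpha$ are exactly the graphs obtained from a cycle $C_l$ with $3\le l\le n-2$ by attaching a path on $n-l\ge 2$ vertices to one vertex of the cycle, and this second largest value equals $(n-4)4^\alpha+3\cdot5^\alpha+3^\alpha$.
   Context: All graphs are finite and simple; $d(v)$ denotes the degree of $v$. A unicyclic graph is a connected graph with exactly one cycle. The general sum-connectivity index is $\chi_\alpha(G)=\sum_{uv\in E(G)}(d(u)+d(v))^\alpha$. Attaching a path $P_r$ (path on $r$ vertices) to a vertex $v$ means adding a disjoint copy of $P_r$ and an edge between $v$ and a terminal vertex of the path. *)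

theory Defs
  imports Complex_Main
begin

definition simple_graph :: "'a set \<Rightarrow> 'a set set \<Rightarrow> bool" where
  "simple_graph V E \<longleftrightarrow> finite V \<and>
     (\<forall>e\<in>E. \<exists>u v. u \<in> V \<and> v \<in> V \<and> u \<noteq> v \<and> e = {u, v})"

definition deg :: "'a set set \<Rightarrow> 'a \<Rightarrow> nat" where
  "deg E v = card {e\<in>E. v \<in> e}"

definition connected_graph :: "'a set \<Rightarrow> 'a set set \<Rightarrow> bool" where
  "connected_graph V E \<longleftrightarrow>
     (\<forall>u\<in>V. \<forall>v\<in>V. (\<lambda>x y. {x, y} \<in> E)\<^sup>*\<^sup>* u v)"

definition cycle_edges :: "'a list \<Rightarrow> 'a set set" where
  "cycle_edges vs = {{vs ! i, vs ! ((i + 1) mod length vs)} | i. i < length vs}"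

definition path_edges :: "'a list \<Rightarrow> 'a set set" where
  "path_edges vs = {{vs ! i, vs ! (i + 1)} | i. i + 1 < length vs}"

definition is_cycle :: "'a set set \<Rightarrow> bool" where
  "is_cycle C \<longleftrightarrow> (\<exists>vs. distinct vs \<and> length vs \<ge> 3 \<and> C = cycle_edges vs)"

definition unicyclic :: "'a set \<Rightarrow> 'a set set \<Rightarrow> bool" where
  "unicyclic V E \<longleftrightarrow> simple_graph V E \<and> connected_graph V E \<and>
     (\<exists>!C. C \<subseteq> E \<and> is_cycle C)"

definition chi :: "real \<Rightarrow> 'a set set \<Rightarrow> real" where
  "chi \<alpha> E = (\<Sum>e\<in>E. real (\<Sum>v\<in>e. deg E v) powr \<alpha>)"

definition is_cycle_graph :: "'a set \<Rightarrow> 'a set set \<Rightarrow> bool" where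
  "is_cycle_graph V E \<longleftrightarrow>
     (\<exists>vs. distinct vs \<and> set vs = V \<and> length vs \<ge> 3 \<and> E = cycle_edges vs)"

definition cycle_with_path :: "'a set \<Rightarrow> 'a set set \<Rightarrow> nat \<Rightarrow> bool" where
  "cycle_with_path V E l \<longleftrightarrow>
     (\<exists>vs ws. distinct (vs @ ws) \<and> set (vs @ ws) = V \<and> length vs = l \<and> l \<ge> 3 \<and>
        ws \<noteq> [] \<and> E = cycle_edges vs \<union> path_edges (hd vs # ws))"

end

theory Submission
  imports Defs
begin

text \<open>Write \<open>f t = t powr \<alpha>\<close>. A unicyclic graph has at most \<open>n\<close> edges, and the sum of
  \<open>1 / d u + 1 / d v\<close> over its edges is at most \<open>n\<close>. With \<open>b = 2 * (f 3 - f 4)\<close> and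
  \<open>s = f 4 - f 5 - b / 6 > 0\<close> every edge \<open>{u, v}\<close> whose ends do not
  both have degree 1 satisfies
  \<open>f (d u + d v) \<le> f 4 - b + b * (1 / d u + 1 / d v)\<close>, and \<open>s\<close> can be subtracted on the right if
  one end has degree at least 3, with equality then only for degrees 2 and 3. The inequality is
  exact for degrees (2, 2) and (1, 2). Summing up, the index is at most \<open>n * f 4 - k * s\<close>, where
  \<open>k\<close> is the number of edges at vertices of degree at least 3. If \<open>k = 0\<close>, the graph is the
  cycle; otherwise \<open>k \<ge> 3\<close>, and the value \<open>n * f 4 - 3 * s\<close> forces a single vertex of degree
  3 and no other vertex of degree above 2, hence a cycle with a pendant path.\<close>

subsection \<open>The edge inequality\<close>

lemma powr_decrease:
  fixes x y \<alpha> :: real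
  assumes "0 < x" "x < y" "\<alpha> < 0"
  shows "y powr \<alpha> < x powr \<alpha>"
  using assms by (simp add: powr_less_mono2_neg)

text \<open>Strict convexity of the power: by the mean value theorem both slopes are values of the
  negated derivative, taken on either side of \<open>b\<close>, and the derivative is strictly
  increasing.\<close>

lemma powr_convex_slopes:
  fixes a b c \<alpha> :: real
  assumes "\<alpha> < 0" "0 < a" "a < b" "b < c"
  shows "(b powr \<alpha> - c powr \<alpha>) / (c - b) < (a powr \<alpha> - b powr \<alpha>) / (b - a)"
proof -
  have D: "((\<lambda>t. t powr \<alpha>) has_real_derivative \<alpha> * t powr (\<alpha> - 1)) (at t)" if "t > 0" for t :: real
    using that has_real_derivative_powr by auto
  obtain z where z: "a < z" "z < b" "b powr \<alpha> - a powr \<alpha> = (b - a) * (\<alpha> * z powr (\<alpha> - 1))"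
    using MVT2[of a b "\<lambda>t. t powr \<alpha>" "\<lambda>t. \<alpha> * t powr (\<alpha> - 1)"] D assms by fastforce
  obtain w where w: "b < w" "w < c" "c powr \<alpha> - b powr \<alpha> = (c - b) * (\<alpha> * w powr (\<alpha> - 1))"
    using MVT2[of b c "\<lambda>t. t powr \<alpha>" "\<lambda>t. \<alpha> * t powr (\<alpha> - 1)"] D assms by fastforce
  have "w powr (\<alpha> - 1) < z powr (\<alpha> - 1)"
    using z w assms by (intro powr_decrease) auto
  then have "\<alpha> * z powr (\<alpha> - 1) < \<alpha> * w powr (\<alpha> - 1)"
    using assms by simp
  moreover have "(b powr \<alpha> - c powr \<alpha>) / (c - b) = - (\<alpha> * w powr (\<alpha> - 1))"
    using w assms by (simp add: field_simps)
  moreover have "(a powr \<alpha> - b powr \<alpha>) / (b - a) = - (\<alpha> * z powr (\<alpha> - 1))"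
    using z assms by (simp add: field_simps)
  ultimately show ?thesis by simp
qed

text \<open>As a function of \<open>1 / t\<close>, \<open>t powr \<alpha>\<close> is a power with exponent in \<open>(0, 1]\<close>, hence concave.
  This reduces the comparison of differences to the case \<open>\<alpha> = -1\<close>.\<close>

lemma powr_inverse_concave_slopes:
  fixes a b c d \<alpha> :: real
  assumes "-1 \<le> \<alpha>" "\<alpha> < 0" "0 < a" "a < b" "b \<le> c" "c < d"
  shows "(a powr \<alpha> - b powr \<alpha>) / (1/a - 1/b) \<le> (c powr \<alpha> - d powr \<alpha>) / (1/c - 1/d)"
proof -
  let ?g = "\<lambda>t::real. t powr (- \<alpha>)"
  have D: "(?g has_real_derivative - \<alpha> * t powr (- \<alpha> - 1)) (at t)" if "t > 0" for t :: real
    using that by (rule has_real_derivative_powr)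
  have g: "?g (1/t) = t powr \<alpha>" if "t > 0" for t
    using that by (simp add: powr_divide powr_minus divide_simps)
  have ord: "0 < 1/d" "1/d < 1/c" "1/c \<le> 1/b" "1/b < 1/a"
    using assms by (auto simp: divide_simps)
  have "\<exists>z>1/b. z < 1/a \<and> ?g (1/a) - ?g (1/b) = (1/a - 1/b) * (- \<alpha> * z powr (- \<alpha> - 1))"
    by (rule MVT2[OF ord(4)], rule D) (use ord in linarith)
  then obtain z where z: "1/b < z" "z < 1/a"
      "?g (1/a) - ?g (1/b) = (1/a - 1/b) * (- \<alpha> * z powr (- \<alpha> - 1))"
    by blast
  have "\<exists>w>1/d. w < 1/c \<and> ?g (1/c) - ?g (1/d) = (1/c - 1/d) * (- \<alpha> * w powr (- \<alpha> - 1))"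
    by (rule MVT2[OF ord(2)], rule D) (use ord in linarith)
  then obtain w where w: "1/d < w" "w < 1/c"
      "?g (1/c) - ?g (1/d) = (1/c - 1/d) * (- \<alpha> * w powr (- \<alpha> - 1))"
    by blast
  \<comment> \<open>The exponent lies in (-1, 0] and \<open>w < 1/c \<le> 1/b < z\<close>; for
    \<open>\<alpha> = -1\<close> both sides are 1, so only a weak inequality results.\<close>
  have "z powr (- \<alpha> - 1) \<le> w powr (- \<alpha> - 1)"
    by (rule powr_mono2') (use z w ord assms in linarith)+
  then have "- \<alpha> * z powr (- \<alpha> - 1) \<le> - \<alpha> * w powr (- \<alpha> - 1)"
    using assms by simp
  moreover have "(a powr \<alpha> - b powr \<alpha>) / (1/a - 1/b) = - \<alpha> * z powr (- \<alpha> - 1)"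
    using z(3) g assms ord by simp
  moreover have "(c powr \<alpha> - d powr \<alpha>) / (1/c - 1/d) = - \<alpha> * w powr (- \<alpha> - 1)"
    using w(3) g assms ord by simp
  ultimately show ?thesis by simp
qed

text \<open>The coefficient is chosen such that the edge inequality is exact for degrees (1, 2).\<close>

definition vertex_coeff :: "real \<Rightarrow> real" where
  "vertex_coeff \<alpha> = 2 * (3 powr \<alpha> - 4 powr \<alpha>)"

text \<open>The loss is the gap in the edge inequality for degrees (2, 3).\<close>

definition branch_loss :: "real \<Rightarrow> real" where
  "branch_loss \<alpha> = 4 powr \<alpha> - 5 powr \<alpha> - (3 powr \<alpha> - 4 powr \<alpha>) / 3"

text \<open>The reciprocals are there for the summation: over all edges, each vertex of positive
  degree collects \<open>vertex_coeff \<alpha>\<close> exactly once. The loss is charged once per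
  edge, even if both ends branch.\<close>

definition edge_bound :: "real \<Rightarrow> nat \<Rightarrow> nat \<Rightarrow> real" where
  "edge_bound \<alpha> x y = 4 powr \<alpha> - vertex_coeff \<alpha> + vertex_coeff \<alpha> * (1 / real x + 1 / real y)
     - (if 3 \<le> x \<or> 3 \<le> y then branch_loss \<alpha> else 0)"

lemma edge_bound_commute: "edge_bound \<alpha> x y = edge_bound \<alpha> y x"
  by (auto simp: edge_bound_def add.commute)

text \<open>Serves twice: for the degree pair (1, 3), and to separate a cycle with one pendant
  vertex from the second largest value.\<close>

lemma powr_345_convex:
  fixes \<alpha> :: real
  assumes "\<alpha> < 0"
  shows "4 powr \<alpha> - 5 powr \<alpha> < 3 powr \<alpha> - 4 powr \<alpha>"
  using powr_convex_slopes[of \<alpha> 3 4 5] assms by simp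

lemma vertex_coeff_pos: "\<alpha> < 0 \<Longrightarrow> 0 < vertex_coeff \<alpha>"
  using powr_decrease[of 3 4 \<alpha>] by (simp add: vertex_coeff_def)

text \<open>Since \<open>1 + \<alpha>\<close> is nonnegative, \<open>t powr (1 + \<alpha>)\<close>
  does not decrease. The result makes the constant term of \<open>edge_bound\<close> nonnegative, so
  that the number of edges may later be replaced by the number of vertices.\<close>

lemma vertex_coeff_le:
  assumes "-1 \<le> \<alpha>"
  shows "vertex_coeff \<alpha> \<le> 4 powr \<alpha>"
proof -
  have "(3::real) powr (1 + \<alpha>) \<le> 4 powr (1 + \<alpha>)"
    using assms by (intro powr_mono2) auto
  then have "3 * 3 powr \<alpha> \<le> 4 * 4 powr \<alpha>"
    by (simp add: powr_add)
  moreover have "(0::real) < 4 powr \<alpha>"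
    by simp
  ultimately have "2 * 3 powr \<alpha> \<le> 3 * 4 powr \<alpha>"
    by argo
  then show ?thesis
    by (simp add: vertex_coeff_def)
qed

text \<open>The reciprocal gaps 1/12 and 1/20 turn the slope comparison into a drop from 4 to 5 of
  at least 3/5 of the drop from 3 to 4, more than the third that is subtracted.\<close>

lemma branch_loss_pos:
  assumes "-1 \<le> \<alpha>" "\<alpha> < 0"
  shows "0 < branch_loss \<alpha>"
  using powr_inverse_concave_slopes[of \<alpha> 3 4 4 5] powr_decrease[of 3 4 \<alpha>] assms
  by (simp add: branch_loss_def)

text \<open>If one end is a leaf, convexity or the sign of the reciprocal term suffices. Otherwise
  the degree sum \<open>m\<close> is at least 6, and the claim follows from
  \<open>1/x + 1/y \<ge> 4/m\<close> and concavity in \<open>1/t\<close>.\<close>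

lemma powr_sum_less_edge_bound:
  assumes "-1 \<le> \<alpha>" "\<alpha> < 0" "1 \<le> x" "3 \<le> y" "(x, y) \<noteq> (2, 3)"
  shows "real (x + y) powr \<alpha> < edge_bound \<alpha> x y"
proof -
  let ?b = "vertex_coeff \<alpha>"
  have b: "0 < ?b" using vertex_coeff_pos assms by simp
  \<comment> \<open>The bound is re-centred at the degrees (2, 3), where it is exact and the
    reciprocals add up to 5/6.\<close>
  have eb: "edge_bound \<alpha> x y = 5 powr \<alpha> + ?b * (1 / real x + 1 / real y - 5/6)"
    using assms by (simp add: edge_bound_def branch_loss_def vertex_coeff_def field_simps)
  show ?thesis
  proof (cases "x = 1")
    case True
    then consider "y = 3" | "4 \<le> y" using assms by linarith
    then show ?thesis
    proof cases
      case 1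
      then show ?thesis
        using True eb powr_345_convex[of \<alpha>] assms by (simp add: vertex_coeff_def field_simps)
    next
      case 2
      then have "real (x + y) powr \<alpha> \<le> 5 powr \<alpha>"
        using True assms by (intro powr_mono2') auto
      moreover have "0 < 1 / real x + 1 / real y - 5/6"
        using True 2 by (simp add: add_pos_nonneg)
      ultimately show ?thesis
        using eb b by (smt (verit) mult_pos_pos)
    qed
  next
    case False
    define m where "m = real x + real y"
    have xy: "2 \<le> x" "6 \<le> x + y" using False assms by auto
    then have m: "6 \<le> m" by (simp add: m_def flip: of_nat_add)
    have "4 * (real x * real y) \<le> m * m"
      using zero_le_power2[of "real x - real y"] by (simp add: m_def power2_eq_square algebra_simps)
    then have "4 / m \<le> 1 / real x + 1 / real y"
      using xy assms m by (simp add: m_def divide_simps) (simp add: algebra_simps)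
    moreover have "2 / m \<le> 1/3" using m by (simp add: divide_simps)
    \<comment> \<open>The margin is at least 6/5 - 5/6 - 1/3 = 1/30.\<close>
    ultimately have *: "0 < 1 / real x + 1 / real y - 5/6 + 6/5 - 6 / m" by argo
    \<comment> \<open>Here 12 is the reciprocal of 1/3 - 1/4, so the left side is six times
      \<open>?b\<close>.\<close>
    have "12 * (3 powr \<alpha> - 4 powr \<alpha>) \<le> (5 powr \<alpha> - m powr \<alpha>) / (1/5 - 1/m)"
      using powr_inverse_concave_slopes[of \<alpha> 3 4 5 m] assms m by simp
    moreover have "0 < 1/5 - 1/m" using m by (simp add: divide_simps)
    ultimately have "12 * (3 powr \<alpha> - 4 powr \<alpha>) * (1/5 - 1/m) \<le> 5 powr \<alpha> - m powr \<alpha>"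
      by (simp add: pos_le_divide_eq)
    then have "?b * (6/5 - 6/m) \<le> 5 powr \<alpha> - m powr \<alpha>"
      by (simp add: vertex_coeff_def algebra_simps)
    moreover have "0 < ?b * (1 / real x + 1 / real y - 5/6 + 6/5 - 6 / m)"
      using b * by (rule mult_pos_pos)
    ultimately show ?thesis
      unfolding eb by (simp add: m_def algebra_simps)
  qed
qed

lemma edge_bound_small:
  "edge_bound \<alpha> 2 2 = 4 powr \<alpha>" "edge_bound \<alpha> 1 2 = 3 powr \<alpha>" "edge_bound \<alpha> 2 3 = 5 powr \<alpha>"
  by (simp_all add: edge_bound_def vertex_coeff_def branch_loss_def field_simps)

text \<open>By symmetry the strict bound covers every pair with an entry of at least 3 except 2 and
  3; the remaining pairs are exact. The pair (1, 1) is excluded because convexity reverses the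
  inequality there.\<close>

lemma powr_sum_eq_edge_bound:
  assumes "-1 \<le> \<alpha>" "\<alpha> < 0" "1 \<le> x" "1 \<le> y" "(x, y) \<noteq> (1, 1)"
  shows "real (x + y) powr \<alpha> \<le> edge_bound \<alpha> x y"
    and "real (x + y) powr \<alpha> = edge_bound \<alpha> x y \<Longrightarrow> 3 \<le> x \<or> 3 \<le> y \<Longrightarrow> {x, y} = {2, 3}"
proof -
  have sym: "real (x + y) powr \<alpha> < edge_bound \<alpha> x y" if "3 \<le> x" "(y, x) \<noteq> (2, 3)"
    using powr_sum_less_edge_bound[of \<alpha> y x] assms that by (simp add: edge_bound_commute add.commute)
  have "x \<in> {1, 2} \<and> y \<in> {1, 2}" if "\<not> 3 \<le> x" "\<not> 3 \<le> y" using that assms by auto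
  then consider "3 \<le> x" "(y, x) \<noteq> (2, 3)" | "3 \<le> y" "(x, y) \<noteq> (2, 3)"
    | "x = 3" "y = 2" | "x = 2" "y = 3" | "x = 1" "y = 2" | "x = 2" "y = 1" | "x = 2" "y = 2"
    using assms by fastforce
  note cases = this
  show "real (x + y) powr \<alpha> \<le> edge_bound \<alpha> x y"
    using cases
    by cases (use sym powr_sum_less_edge_bound[of \<alpha> x y] assms edge_bound_small[of \<alpha>]
        edge_bound_commute[of \<alpha> x y] in auto)
  show "{x, y} = {2, 3}" if "real (x + y) powr \<alpha> = edge_bound \<alpha> x y" "3 \<le> x \<or> 3 \<le> y"
    using cases
    by cases (use that sym powr_sum_less_edge_bound[of \<alpha> x y] assms in auto)
qed

subsection \<open>Graphs, degrees and saturated subgraphs\<close>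

lemma simple_graph_finite_edges: "simple_graph V E \<Longrightarrow> finite E"
  by (rule finite_subset[of _ "Pow V"]) (auto simp: simple_graph_def)

lemma simple_graph_Union_edges: "simple_graph V E \<Longrightarrow> \<Union>E \<subseteq> V"
  by (auto simp: simple_graph_def)

lemma simple_graph_edge:
  assumes "simple_graph V E" "{u, v} \<in> E"
  shows "u \<noteq> v" "u \<in> V" "v \<in> V"
proof -
  obtain a b where "a \<in> V" "b \<in> V" "a \<noteq> b" "{u, v} = {a, b}"
    using assms by (auto simp: simple_graph_def)
  then show "u \<noteq> v" "u \<in> V" "v \<in> V"
    by (auto simp: doubleton_eq_iff)
qed

lemma simple_graph_edgeE:
  assumes "simple_graph V E" "e \<in> E" "v \<in> e"
  obtains u where "e = {v, u}" "u \<noteq> v" "u \<in> V" "v \<in> V"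
proof -
  obtain a b where "a \<in> V" "b \<in> V" "a \<noteq> b" "e = {a, b}"
    using assms by (auto simp: simple_graph_def)
  then show ?thesis
    using assms(3) that[of a] that[of b] by (auto simp: insert_commute)
qed

lemma connected_graph_closed:
  assumes "connected_graph V E" "s \<in> S" "s \<in> V"
    and "\<And>u v. u \<in> S \<Longrightarrow> {u, v} \<in> E \<Longrightarrow> v \<in> S"
  shows "V \<subseteq> S"
proof
  fix v assume "v \<in> V"
  then have "(\<lambda>x y. {x, y} \<in> E)\<^sup>*\<^sup>* s v"
    using assms by (simp add: connected_graph_def)
  then show "v \<in> S"
    using assms(2,4) by (induction rule: rtranclp_induct) auto
qed

text \<open>The edges of \<open>A\<close> at \<open>v\<close> are among those of \<open>E\<close> at
  \<open>v\<close>, and the degree leaves no room for another one.\<close>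

lemma edge_in_subgraph_if_deg_le:
  assumes "finite E" "A \<subseteq> E" "deg E v \<le> deg A v" "e \<in> E" "v \<in> e"
  shows "e \<in> A"
proof -
  have "{e \<in> A. v \<in> e} = {e \<in> E. v \<in> e}"
    using assms(1-3) by (intro card_seteq) (auto simp: deg_def)
  then show ?thesis using assms(4,5) by blast
qed

lemma deg_Un_disjoint:
  assumes "finite A" "finite B" "A \<inter> B = {}"
  shows "deg (A \<union> B) v = deg A v + deg B v"
proof -
  have "{e \<in> A \<union> B. v \<in> e} = {e \<in> A. v \<in> e} \<union> {e \<in> B. v \<in> e}" by blast
  then show ?thesis
    using assms by (simp add: deg_def card_Un_disjoint disjoint_iff)
qed

lemma deg_eq_0: "v \<notin> \<Union>A \<Longrightarrow> deg A v = 0"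
  unfolding deg_def by (metis (no_types, lifting) UnionI card.empty empty_Collect_eq)

text \<open>Double counting of incident pairs. With \<open>h v\<close> a constant divided by the
  degree of \<open>v\<close>, the right side is at most that constant times the number of
  vertices.\<close>

lemma sum_over_edge_ends:
  fixes h :: "'a \<Rightarrow> real"
  assumes "simple_graph V E"
  shows "(\<Sum>e\<in>E. \<Sum>v\<in>e. h v) = (\<Sum>v\<in>V. real (deg E v) * h v)"
proof -
  have fin: "finite V" "finite E"
    using assms simple_graph_finite_edges by (auto simp: simple_graph_def)
  have "(\<Sum>e\<in>E. \<Sum>v\<in>e. h v) = (\<Sum>e\<in>E. \<Sum>v\<in>V. if v \<in> e then h v else 0)"
  proof (rule sum.cong)
    fix e assume "e \<in> E"
    then have "V \<inter> e = e" using assms by (auto simp: simple_graph_def)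
    then show "(\<Sum>v\<in>e. h v) = (\<Sum>v\<in>V. if v \<in> e then h v else 0)"
      using fin sum.inter_restrict[of V h e] by simp
  qed simp
  also have "\<dots> = (\<Sum>v\<in>V. \<Sum>e\<in>E. if v \<in> e then h v else 0)"
    by (rule sum.swap)
  also have "\<dots> = (\<Sum>v\<in>V. real (deg E v) * h v)"
    using fin by (intro sum.cong) (auto simp: deg_def simp flip: sum.inter_filter)
  finally show ?thesis .
qed

subsection \<open>Cycles and paths given by vertex lists\<close>

abbreviation cyc_edge :: "'a list \<Rightarrow> nat \<Rightarrow> 'a set" where
  "cyc_edge vs i \<equiv> {vs ! i, vs ! ((i + 1) mod length vs)}"

abbreviation path_edge :: "'a list \<Rightarrow> nat \<Rightarrow> 'a set" where
  "path_edge ps i \<equiv> {ps ! i, ps ! (i + 1)}"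

lemma cycle_edges_image: "cycle_edges vs = cyc_edge vs ` {..<length vs}"
  by (auto simp: cycle_edges_def)

lemma path_edges_image: "path_edges ps = path_edge ps ` {..<length ps - 1}"
  by (auto simp: path_edges_def)

lemma Suc_mod_eq: "i < n \<Longrightarrow> Suc i mod n = (if Suc i = n then 0 else Suc i)"
  by (auto simp: mod_Suc)

lemma cycle_edges_eq_empty_iff [simp]: "cycle_edges vs = {} \<longleftrightarrow> vs = []"
  by (simp add: cycle_edges_image lessThan_empty_iff)

text \<open>The length must exceed 2: on two vertices both indices would give the same edge.\<close>

lemma inj_on_cyc_edge:
  assumes "distinct vs" "3 \<le> length vs"
  shows "inj_on (cyc_edge vs) {..<length vs}"
proof (rule inj_onI)
  have "vs \<noteq> []" using assms by auto
  fix i j assume "i \<in> {..<length vs}" "j \<in> {..<length vs}" "cyc_edge vs i = cyc_edge vs j"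
  then show "i = j"
    using assms \<open>vs \<noteq> []\<close>
    by (auto simp: doubleton_eq_iff nth_eq_iff_index_eq Suc_mod_eq split: if_splits)
qed

lemma inj_on_path_edge:
  assumes "distinct ps"
  shows "inj_on (path_edge ps) {..<length ps - 1}"
  using assms by (auto simp: inj_on_def doubleton_eq_iff nth_eq_iff_index_eq)

lemma Union_cycle_edges: "\<Union>(cycle_edges vs) = set vs"
proof
  show "set vs \<subseteq> \<Union>(cycle_edges vs)"
    by (force simp: cycle_edges_image in_set_conv_nth)
  show "\<Union>(cycle_edges vs) \<subseteq> set vs"
    by (auto simp: cycle_edges_image)
      (metis length_pos_if_in_set less_nat_zero_code mod_less_divisor neq0_conv nth_mem)+
qed

lemma finite_cycle_edges [simp]: "finite (cycle_edges vs)"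
  by (simp add: cycle_edges_image)

lemma finite_path_edges [simp]: "finite (path_edges ps)"
  by (simp add: path_edges_image)

lemma card_cycle_edges:
  "distinct vs \<Longrightarrow> 3 \<le> length vs \<Longrightarrow> card (cycle_edges vs) = length vs"
  by (simp only: cycle_edges_image card_image[OF inj_on_cyc_edge] card_lessThan)

lemma deg_cycle_edges:
  assumes "distinct vs" "3 \<le> length vs" "v \<in> set vs"
  shows "deg (cycle_edges vs) v = 2"
proof -
  let ?l = "length vs"
  obtain i where i: "i < ?l" "v = vs ! i"
    using assms(3) by (auto simp: in_set_conv_nth)
  have "vs \<noteq> []" using assms by auto
  \<comment> \<open>The index of the edge arriving at \<open>v\<close>, wrapping round from the
    first position to the last.\<close>
  define j where "j = (if i = 0 then ?l - 1 else i - 1)"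
  have "{k. k < ?l \<and> v \<in> cyc_edge vs k} = {i, j}"
    using i assms \<open>vs \<noteq> []\<close>
    by (auto simp: j_def nth_eq_iff_index_eq Suc_mod_eq split: if_splits dest!: dvd_imp_le)
  moreover have "{e \<in> cycle_edges vs. v \<in> e} = cyc_edge vs ` {k. k < ?l \<and> v \<in> cyc_edge vs k}"
    by (auto simp: cycle_edges_image)
  moreover have "inj_on (cyc_edge vs) {k. k < ?l \<and> v \<in> cyc_edge vs k}"
    by (rule inj_on_subset[OF inj_on_cyc_edge]) (use assms in auto)
  moreover have "i \<noteq> j" using assms i by (auto simp: j_def)
  ultimately show ?thesis by (simp add: deg_def card_image)
qed

lemma deg_path_edges:
  assumes "distinct ps" "i < length ps"
  shows "deg (path_edges ps) (ps ! i)
    = (if i = 0 then 0 else 1) + (if i + 1 = length ps then 0 else 1)"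
proof -
  let ?K = "{k. k < length ps - 1 \<and> ps ! i \<in> path_edge ps k}"
  have "?K = (if i = 0 then {} else {i - 1}) \<union> (if i + 1 = length ps then {} else {i})"
    using assms by (cases "length ps") (auto simp: nth_eq_iff_index_eq)
  moreover have "{e \<in> path_edges ps. ps ! i \<in> e} = path_edge ps ` ?K"
    by (auto simp: path_edges_image)
  moreover have "inj_on (path_edge ps) ?K"
    by (rule inj_on_subset[OF inj_on_path_edge]) (use assms in auto)
  ultimately show ?thesis by (simp add: deg_def card_image)
qed

lemma Union_path_edges: "\<Union>(path_edges ps) \<subseteq> set ps"
  by (auto simp: path_edges_image)

lemma path_edges_singleton [simp]: "path_edges [x] = {}"
  by (simp add: path_edges_image)

lemma path_edges_Cons: "ps \<noteq> [] \<Longrightarrow> path_edges (x # ps) = insert {x, hd ps} (path_edges ps)"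
proof -
  assume ps: "ps \<noteq> []"
  then have "{..<length (x # ps) - 1} = insert 0 (Suc ` {..<length ps - 1})"
    by (cases ps) (simp_all add: lessThan_Suc_eq_insert_0)
  then have "path_edges (x # ps) = insert (path_edge (x # ps) 0)
      (path_edge (x # ps) ` Suc ` {..<length ps - 1})"
    unfolding path_edges_image by simp
  then show ?thesis
    using ps by (simp add: path_edges_image image_image hd_conv_nth)
qed

lemma path_edges_snoc: "ps \<noteq> [] \<Longrightarrow> path_edges (ps @ [x]) = insert {last ps, x} (path_edges ps)"
  by (induction ps) (auto simp: path_edges_Cons)

text \<open>Brings the branching vertex to the front, where the path is attached. A rotation only
  permutes the edge indices cyclically.\<close>

lemma cycle_edges_rotate:
  assumes "w \<in> set vs"
  obtains vs' where "hd vs' = w" "set vs' = set vs" "length vs' = length vs"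
    "distinct vs' = distinct vs" "cycle_edges vs' = cycle_edges vs"
proof -
  have rot: "cycle_edges (rotate1 xs) = cycle_edges xs" for xs :: "'a list"
  proof (cases xs)
    case (Cons a as)
    let ?l = "length xs"
    have l: "0 < ?l" using Cons by simp
    have "cyc_edge (rotate1 xs) i = cyc_edge xs (Suc i mod ?l)" if "i < ?l" for i
      using that l by (simp add: nth_rotate1 mod_simps)
    then have "cycle_edges (rotate1 xs) = cyc_edge xs ` (\<lambda>i. Suc i mod ?l) ` {..<?l}"
      by (auto simp: cycle_edges_image image_image)
    also have "(\<lambda>i. Suc i mod ?l) ` {..<?l} = {..<?l}"
    proof (rule endo_inj_surj)
      show "inj_on (\<lambda>i. Suc i mod ?l) {..<?l}"
        by (auto simp: inj_on_def Suc_mod_eq split: if_splits)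
    qed (use l in auto)
    finally show ?thesis by (simp add: cycle_edges_image)
  qed simp
  have rotn: "cycle_edges (rotate k vs) = cycle_edges vs" for k
    by (induction k) (simp_all add: rot)
  obtain i where i: "i < length vs" "vs ! i = w"
    using assms by (auto simp: in_set_conv_nth)
  then have "hd (rotate i vs) = w"
    using hd_rotate_conv_nth[of vs i] by (cases vs) auto
  then show ?thesis using that[of "rotate i vs"] rotn by simp
qed

subsection \<open>Structure of unicyclic graphs\<close>

lemma is_cycle_deg:
  assumes "is_cycle C" "v \<in> \<Union>C"
  shows "deg C v = 2"
  using assms deg_cycle_edges unfolding is_cycle_def by (metis Union_cycle_edges)

lemma is_cycle_edgeE:
  assumes "is_cycle C"
  obtains u v where "{u, v} \<in> C"
proof -
  obtain vs where "length vs \<ge> 3" "C = cycle_edges vs"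
    using assms by (auto simp: is_cycle_def)
  then have "cyc_edge vs 0 \<in> C" by (auto simp: cycle_edges_image)
  then show ?thesis using that by blast
qed

section \<open>Existence of cycles and the number of edges\<close>

lemma card_neighbours:
  assumes "simple_graph V E"
  shows "card {u. {v, u} \<in> E} = deg E v"
proof -
  have "{e \<in> E. v \<in> e} = (\<lambda>u. {v, u}) ` {u. {v, u} \<in> E}"
  proof (intro equalityI subsetI)
    fix e assume e: "e \<in> {e \<in> E. v \<in> e}"
    then obtain u where "e = {v, u}" using simple_graph_edgeE[OF assms, of e v] by blast
    then show "e \<in> (\<lambda>u. {v, u}) ` {u. {v, u} \<in> E}" using e by blast
  qed auto
  moreover have "inj_on (\<lambda>u. {v, u}) {u. {v, u} \<in> E}"
    by (auto simp: inj_on_def doubleton_eq_iff)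
  ultimately show ?thesis by (simp add: deg_def card_image)
qed

text \<open>Lengths of distinct lists over \<open>V\<close> are bounded by \<open>card V\<close>, so
  a greatest one is attained.\<close>

lemma ex_longest_distinct_list:
  assumes "finite V" "P ps" "\<And>ps. P ps \<Longrightarrow> distinct ps \<and> set ps \<subseteq> V"
  shows "\<exists>qs. P qs \<and> (\<forall>rs. P rs \<longrightarrow> length rs \<le> length qs)"
proof -
  have "length rs \<le> card V" if "P rs" for rs
    using assms(1) assms(3)[OF that] card_mono[of V "set rs"] by (simp add: distinct_card)
  then show ?thesis
    using ex_has_greatest_nat[of P ps length "Suc (card V)"] assms(2) by (simp add: less_Suc_eq_le)
qed

text \<open>On a longest path every neighbour of the first vertex lies on the path; a neighbour
  other than the second vertex closes a cycle.\<close>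

lemma min_deg_2_imp_cycle:
  assumes "simple_graph V E" "V \<noteq> {}" "\<And>v. v \<in> V \<Longrightarrow> 2 \<le> deg E v"
  obtains C where "C \<subseteq> E" "is_cycle C"
proof -
  let ?P = "\<lambda>ps. distinct ps \<and> ps \<noteq> [] \<and> set ps \<subseteq> V \<and> path_edges ps \<subseteq> E"
  obtain v where "v \<in> V" using assms(2) by blast
  then have "?P [v]" by simp
  moreover have "finite V" using assms(1) by (simp add: simple_graph_def)
  ultimately have "\<exists>ps. ?P ps \<and> (\<forall>rs. ?P rs \<longrightarrow> length rs \<le> length ps)"
    by (intro ex_longest_distinct_list[of V ?P "[v]"]) simp_all
  then obtain ps where ps: "?P ps" and max: "\<forall>rs. ?P rs \<longrightarrow> length rs \<le> length ps"
    by blast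
  define w where "w = hd ps"
  have w: "ps ! 0 = w" "w \<in> V" using ps by (auto simp: w_def hd_conv_nth)
  have nb: "u \<in> set ps" if "{w, u} \<in> E" for u
  proof (rule ccontr)
    assume "u \<notin> set ps"
    then have "?P (u # ps)"
      using ps that simple_graph_edge[OF assms(1) that]
      by (auto simp: path_edges_Cons w_def insert_commute)
    then show False using max[rule_format, of "u # ps"] by simp
  qed
  \<comment> \<open>For a one-vertex path \<open>ps ! 1\<close> is unspecified; all that counts is
    that one value cannot exhaust two neighbours.\<close>
  have "\<not> {u. {w, u} \<in> E} \<subseteq> {ps ! 1}"
  proof
    assume "{u. {w, u} \<in> E} \<subseteq> {ps ! 1}"
    then have "card {u. {w, u} \<in> E} \<le> card {ps ! 1}" by (intro card_mono) auto
    then show False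
      using assms(3)[OF w(2)] card_neighbours[OF assms(1), of w] by simp
  qed
  then obtain u where u: "{w, u} \<in> E" "u \<noteq> ps ! 1" by blast
  then obtain i where i: "i < length ps" "u = ps ! i"
    using nb by (metis in_set_conv_nth)
  have "i \<noteq> 0" "i \<noteq> 1"
    using u i w simple_graph_edge(1)[OF assms(1) u(1)] by (auto intro: ccontr)
  \<comment> \<open>The initial segment up to \<open>u\<close>, closed by the edge from
    \<open>u\<close> back to \<open>w\<close>. It has at least three vertices because
    \<open>i\<close> is neither 0 nor 1.\<close>
  define vs where "vs = take (Suc i) ps"
  have len: "length vs = Suc i" and dist: "distinct vs"
    using i ps by (auto simp: vs_def)
  have "cyc_edge vs k \<in> E" if "k < length vs" for k
  proof (cases "k = i")
    case True
    then have "cyc_edge vs k = {w, u}"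
      using len i w by (auto simp: vs_def)
    then show ?thesis using u by simp
  next
    case False
    then have "cyc_edge vs k = path_edge ps k" "k < length ps - 1"
      using len i that by (auto simp: vs_def)
    then show ?thesis using ps by (auto simp: path_edges_image)
  qed
  then have "cycle_edges vs \<subseteq> E" by (auto simp: cycle_edges_image)
  moreover have "is_cycle (cycle_edges vs)"
    using len dist \<open>i \<noteq> 0\<close> \<open>i \<noteq> 1\<close> unfolding is_cycle_def by (intro exI[of _ vs]) auto
  ultimately show ?thesis by (rule that)
qed

text \<open>Without a cycle some vertex has degree at most 1. Deleting it costs one vertex and at
  most one edge, and induction applies.\<close>

lemma acyclic_card_edges:
  assumes "simple_graph V E" "V \<noteq> {}" "\<nexists>C. C \<subseteq> E \<and> is_cycle C"
  shows "card E < card V"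
  using assms
proof (induction "card V" arbitrary: V E)
  case 0
  then show ?case by (auto simp: simple_graph_def)
next
  case (Suc n)
  have fin: "finite V" "finite E"
    using Suc.prems(1) simple_graph_finite_edges by (auto simp: simple_graph_def)
  obtain v where v: "v \<in> V" "deg E v \<le> 1"
    using min_deg_2_imp_cycle[OF Suc.prems(1,2)] Suc.prems(3)
    by (metis Suc_1 not_less_eq_eq)
  define E' where "E' = {e \<in> E. v \<notin> e}"
  have cardE: "card E = card E' + deg E v"
  proof -
    have "E = E' \<union> {e \<in> E. v \<in> e}" by (auto simp: E'_def)
    then show ?thesis
      using fin card_Un_disjoint[of E' "{e \<in> E. v \<in> e}"] by (auto simp: E'_def deg_def)
  qed
  have simple: "simple_graph (V - {v}) E'"
    using Suc.prems(1) unfolding simple_graph_def E'_def by fastforce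
  show ?case
  proof (cases "V = {v}")
    case True
    then have "E' = {}" using simple by (auto simp: simple_graph_def)
    moreover have "deg E v = 0"
      using Suc.prems(1) True by (auto simp: simple_graph_def deg_def)
    ultimately show ?thesis using cardE True by simp
  next
    case False
    have "card E' < card (V - {v})"
    proof (rule Suc.hyps(1)[OF _ simple])
      show "n = card (V - {v})" using Suc.hyps(2) v fin by simp
      show "V - {v} \<noteq> {}" using False v by blast
      show "\<nexists>C. C \<subseteq> E' \<and> is_cycle C" using Suc.prems(3) by (auto simp: E'_def)
    qed
    then show ?thesis using cardE v fin by (simp add: card_Diff_singleton)
  qed
qed

lemma unicyclicD:
  assumes "unicyclic V E"
  shows "simple_graph V E" "connected_graph V E" "finite V" "finite E"
  using assms simple_graph_finite_edges by (auto simp: unicyclic_def simple_graph_def)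

text \<open>Deleting one edge of the only cycle leaves an acyclic graph on the same
  vertices.\<close>

lemma unicyclic_card_edges:
  assumes "unicyclic V E"
  shows "card E \<le> card V"
proof -
  obtain C where C: "C \<subseteq> E" "is_cycle C" "\<And>D. D \<subseteq> E \<Longrightarrow> is_cycle D \<Longrightarrow> D = C"
    using assms by (auto simp: unicyclic_def)
  note E = unicyclicD[OF assms]
  obtain u v where e: "{u, v} \<in> C" using C is_cycle_edgeE by blast
  have "card (E - {{u, v}}) < card V"
  proof (rule acyclic_card_edges)
    show "simple_graph V (E - {{u, v}})"
      using E(1) by (auto simp: simple_graph_def)
    show "V \<noteq> {}" using E(1) e C(1) simple_graph_edge by fastforce
    show "\<nexists>D. D \<subseteq> E - {{u, v}} \<and> is_cycle D"
      using C(3) e by blast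
  qed
  then show ?thesis using E(4) by (simp add: card_Diff_singleton_if split: if_splits)
qed

section \<open>Recognising a graph by a saturated subgraph\<close>

lemma unicyclic_cycleE:
  assumes "unicyclic V E"
  obtains vs where "distinct vs" "3 \<le> length vs" "cycle_edges vs \<subseteq> E" "set vs \<subseteq> V"
proof -
  obtain vs where vs: "distinct vs" "3 \<le> length vs" "cycle_edges vs \<subseteq> E"
    using assms by (auto simp: unicyclic_def is_cycle_def)
  moreover have "set vs \<subseteq> V"
    using vs(3) simple_graph_Union_edges[OF unicyclicD(1)[OF assms]] Union_cycle_edges[of vs] by blast
  ultimately show ?thesis by (rule that)
qed

text \<open>No edge of \<open>E\<close> leaves the vertices covered by \<open>A\<close>, so
  connectivity makes them all of \<open>V\<close>; then every edge has a saturated end and belongs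
  to \<open>A\<close>.\<close>

lemma saturated_subgraph_eq:
  assumes "simple_graph V E" "connected_graph V E" "A \<subseteq> E" "A \<noteq> {}"
    and sat: "\<And>v. v \<in> \<Union>A \<Longrightarrow> deg E v \<le> deg A v"
  shows "A = E" "\<Union>A = V"
proof -
  have fin: "finite E" using assms(1) by (rule simple_graph_finite_edges)
  have closed: "e \<in> A" if "v \<in> \<Union>A" "e \<in> E" "v \<in> e" for v e
    using edge_in_subgraph_if_deg_le[OF fin assms(3) sat] that by blast
  obtain e where "e \<in> A" using assms(4) by blast
  then obtain s where s: "s \<in> \<Union>A" "s \<in> V"
    using assms(1,3) unfolding simple_graph_def by blast
  have "V \<subseteq> \<Union>A"
    by (rule connected_graph_closed[OF assms(2) s]) (use closed in blast)
  moreover have "\<Union>A \<subseteq> V" using assms(3) simple_graph_Union_edges[OF assms(1)] by blast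
  ultimately show "\<Union>A = V" by blast
  show "A = E"
  proof
    show "E \<subseteq> A"
    proof
      fix e assume e: "e \<in> E"
      then obtain v where "v \<in> e" "v \<in> V" using assms(1) by (auto simp: simple_graph_def)
      then show "e \<in> A" using closed e \<open>V \<subseteq> \<Union>A\<close> by blast
    qed
  qed (rule assms(3))
qed

text \<open>The cycle already gives each of its vertices degree 2, so it is saturated.\<close>

lemma max_deg_2_imp_cycle_graph:
  assumes "unicyclic V E" "\<And>v. v \<in> V \<Longrightarrow> deg E v \<le> 2"
  shows "is_cycle_graph V E"
proof -
  note E = unicyclicD[OF assms(1)]
  obtain vs where vs: "distinct vs" "3 \<le> length vs" "cycle_edges vs \<subseteq> E" "set vs \<subseteq> V"
    using assms(1) by (rule unicyclic_cycleE)
  have "cycle_edges vs \<noteq> {}" using vs(2) by auto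
  moreover have "deg E v \<le> deg (cycle_edges vs) v" if "v \<in> \<Union>(cycle_edges vs)" for v
    using that vs assms(2) by (auto simp: Union_cycle_edges deg_cycle_edges)
  ultimately have "cycle_edges vs = E" "\<Union>(cycle_edges vs) = V"
    using saturated_subgraph_eq[OF E(1,2) vs(3)] by blast+
  moreover have "\<Union>(cycle_edges vs) = set vs" by (rule Union_cycle_edges)
  ultimately show ?thesis using vs(1,2) unfolding is_cycle_graph_def by metis
qed

section \<open>Cycles with a pendant path\<close>

definition lollipop :: "'a list \<Rightarrow> 'a list \<Rightarrow> 'a set set" where
  "lollipop vs ws = cycle_edges vs \<union> path_edges (hd vs # ws)"

text \<open>The later end of each path edge belongs to \<open>ws\<close> and hence lies off the
  cycle.\<close>

lemma cycle_path_disjoint: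
  assumes "distinct (vs @ ws)"
  shows "cycle_edges vs \<inter> path_edges (hd vs # ws) = {}"
proof -
  have "e \<notin> cycle_edges vs" if "e \<in> path_edges (hd vs # ws)" for e
  proof -
    have "\<exists>i<length ws. e = path_edge (hd vs # ws) i"
      using that unfolding path_edges_image by auto
    then obtain w where "w \<in> set ws" "w \<in> e" using nth_mem by force
    moreover have "w \<notin> set vs" using assms calculation(1) by auto
    ultimately show ?thesis using Union_cycle_edges[of vs] by blast
  qed
  then show ?thesis by blast
qed

lemma deg_lollipop:
  assumes "distinct (vs @ ws)" "3 \<le> length vs"
  shows "v \<in> set vs \<Longrightarrow> deg (lollipop vs ws) v = (if v = hd vs \<and> ws \<noteq> [] then 3 else 2)"
    and "j < length ws \<Longrightarrow> deg (lollipop vs ws) (ws ! j) = (if j + 1 = length ws then 1 else 2)"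
proof -
  let ?p = "hd vs # ws"
  have "vs \<noteq> []" using assms by auto
  then have dp: "distinct ?p" using assms by (cases vs) auto
  have d: "deg (lollipop vs ws) v = deg (cycle_edges vs) v + deg (path_edges ?p) v" for v
    unfolding lollipop_def
    by (rule deg_Un_disjoint) (use cycle_path_disjoint[OF assms(1)] in auto)
  show "deg (lollipop vs ws) v = (if v = hd vs \<and> ws \<noteq> [] then 3 else 2)" if v: "v \<in> set vs"
  proof (cases "v = hd vs")
    case True
    then show ?thesis
      using deg_path_edges[OF dp, of 0] d[of v] v assms by (auto simp: deg_cycle_edges)
  next
    case False
    then have "v \<notin> set ?p" using assms v by auto
    then have "v \<notin> \<Union>(path_edges ?p)" using Union_path_edges[of ?p] by blast
    then show ?thesis using False d[of v] v assms by (simp add: deg_cycle_edges deg_eq_0)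
  qed
  show "deg (lollipop vs ws) (ws ! j) = (if j + 1 = length ws then 1 else 2)" if "j < length ws"
  proof -
    have "ws ! j \<notin> \<Union>(cycle_edges vs)"
      using nth_mem[OF that] assms(1) unfolding Union_cycle_edges by auto
    then show ?thesis
      using deg_path_edges[OF dp, of "Suc j"] d[of "ws ! j"] that by (simp add: deg_eq_0)
  qed
qed

lemma Union_lollipop:
  assumes "vs \<noteq> []"
  shows "\<Union>(lollipop vs ws) = set (vs @ ws)"
proof -
  have "w \<in> \<Union>(path_edges (hd vs # ws))" if w: "w \<in> set ws" for w
  proof -
    obtain i where i: "i < length ws" "w = ws ! i" using w by (auto simp: in_set_conv_nth)
    then have "w \<in> path_edge (hd vs # ws) i" by simp
    then show ?thesis using i unfolding path_edges_image by auto
  qed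
  moreover have "\<Union>(path_edges (hd vs # ws)) \<subseteq> set (vs @ ws)"
    using Union_path_edges[of "hd vs # ws"] assms by auto
  ultimately show ?thesis
    unfolding lollipop_def Union_Un_distrib Union_cycle_edges by auto
qed

text \<open>A longest path growing out of the cycle at the branching vertex leaves no edge uncovered:
  an uncovered edge at a vertex whose degree is already used up does not exist, and one at the
  end of the path would prolong it.\<close>

lemma one_branching_vertex_imp_lollipop:
  assumes uni: "unicyclic V E"
    and w: "w \<in> V" "deg E w = 3"
    and small: "\<And>v. v \<in> V \<Longrightarrow> v \<noteq> w \<Longrightarrow> deg E v \<le> 2"
  obtains l where "3 \<le> l" "cycle_with_path V E l"
proof -
  note E = unicyclicD[OF uni]
  obtain us where us: "distinct us" "3 \<le> length us" "cycle_edges us \<subseteq> E" "set us \<subseteq> V"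
    using uni by (rule unicyclic_cycleE)
  have "w \<in> set us"
  \<comment> \<open>A cycle avoiding \<open>w\<close> would have only vertices of degree at most 2,
    so it would be saturated and cover \<open>w\<close> after all.\<close>
  proof (rule ccontr)
    assume "w \<notin> set us"
    then have "deg E v \<le> deg (cycle_edges us) v" if "v \<in> set us" for v
      using us that small by (auto simp: deg_cycle_edges)
    moreover have "cycle_edges us \<noteq> {}" using us(2) by auto
    ultimately have "set us = V"
      using saturated_subgraph_eq(2)[OF E(1,2) us(3)] by (simp add: Union_cycle_edges)
    then show False using \<open>w \<notin> set us\<close> w by simp
  qed
  then obtain vs where hd: "hd vs = w" and vs: "distinct vs" "3 \<le> length vs"
    "cycle_edges vs \<subseteq> E" "set vs \<subseteq> V"
    using cycle_edges_rotate[of w us] us by metis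
  then have ne: "vs \<noteq> []" by auto
  let ?P = "\<lambda>ws. distinct (vs @ ws) \<and> set ws \<subseteq> V \<and> lollipop vs ws \<subseteq> E"
  \<comment> \<open>The bare cycle is the starting point for growing the path.\<close>
  have "?P []" using vs by (simp add: lollipop_def)
  then have "\<exists>ws. ?P ws \<and> (\<forall>xs. ?P xs \<longrightarrow> length xs \<le> length ws)"
    by (rule ex_longest_distinct_list[OF E(3)]) simp
  then obtain ws where ws: "?P ws" and max: "\<forall>xs. ?P xs \<longrightarrow> length xs \<le> length ws"
    by blast
  let ?A = "lollipop vs ws"
  \<comment> \<open>The free end of the path, which is \<open>w\<close> itself as long as the path
    is empty; every other vertex is already saturated.\<close>
  define z where "z = last (w # ws)"
  have A: "distinct (vs @ ws)" "?A \<subseteq> E" using ws by auto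
  note dA = deg_lollipop[OF A(1) vs(2)]
  have sat: "deg E v \<le> deg ?A v" if v: "v \<in> set (vs @ ws)" "v \<noteq> z" for v
  proof (cases "v \<in> set vs")
    case True
    then have "v \<in> V" using vs by blast
    moreover have "ws \<noteq> []" if "v = w" using that v by (auto simp: z_def)
    ultimately show ?thesis
      using dA(1)[OF True] small[of v] w hd by (cases "v = w") auto
  next
    case False
    then obtain j where j: "j < length ws" "v = ws ! j"
      using v by (auto simp: in_set_conv_nth)
    have "j + 1 \<noteq> length ws"
    proof
      assume "j + 1 = length ws"
      then have "ws \<noteq> []" "length ws - 1 = j" by auto
      then have "last (w # ws) = ws ! j" by (simp add: last_conv_nth)
      then show False using v(2) j(2) by (simp add: z_def)
    qed
    moreover have "v \<in> V" using j ws by auto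
    moreover have "v \<noteq> w" using False hd ne by auto
    ultimately show ?thesis using dA(2)[OF j(1)] j small[of v] by simp
  qed
  have zA: "deg E z \<le> deg ?A z"
  proof (rule ccontr)
    assume "\<not> ?thesis"
    then have "\<not> {e \<in> E. z \<in> e} \<subseteq> {e \<in> ?A. z \<in> e}"
      using card_mono[of "{e \<in> ?A. z \<in> e}" "{e \<in> E. z \<in> e}"] finite_subset[OF A(2) E(4)]
      by (auto simp: deg_def)
    then obtain e where e: "e \<in> E" "z \<in> e" "e \<notin> ?A" by blast
    then obtain u where u: "e = {z, u}" "u \<noteq> z" "u \<in> V"
      using simple_graph_edgeE[OF E(1)] by metis
    \<comment> \<open>The other end of a missed edge cannot be a saturated vertex, so it is new and
      the path could be prolonged.\<close>
    have "u \<notin> set (vs @ ws)"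
      using edge_in_subgraph_if_deg_le[OF E(4) A(2) sat, of u e] u e by auto
    moreover have "lollipop vs (ws @ [u]) = insert e ?A"
      using path_edges_snoc[of "w # ws" u] hd u by (auto simp: lollipop_def z_def)
    ultimately have "?P (ws @ [u])" using ws e u by auto
    then show False using max[rule_format, of "ws @ [u]"] by simp
  qed
  have satA: "deg E v \<le> deg ?A v" if "v \<in> \<Union>?A" for v
    using sat[of v] zA that Union_lollipop[OF ne, of ws] by (cases "v = z") auto
  have "?A \<noteq> {}" using vs(2) by (auto simp: lollipop_def)
  then have "?A = E" "set (vs @ ws) = V"
    using saturated_subgraph_eq[OF E(1,2) A(2)] satA Union_lollipop[OF ne, of ws] by simp_all
  \<comment> \<open>Otherwise \<open>w\<close> would be saturated with only the two cycle edges,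
    although its degree is 3.\<close>
  moreover have "ws \<noteq> []"
  proof
    assume "ws = []"
    then have "z = w" "z \<in> set vs" using hd ne by (auto simp: z_def)
    then show False using zA dA(1)[of z] w \<open>ws = []\<close> by simp
  qed
  ultimately have "cycle_with_path V E (length vs)"
    using A vs unfolding cycle_with_path_def lollipop_def by (intro exI[of _ vs] exI[of _ ws]) simp
  then show ?thesis using that vs by blast
qed

subsection \<open>Cycles and cycles with a pendant path are unicyclic\<close>

lemma connected_graph_root:
  assumes "\<And>v. v \<in> V \<Longrightarrow> (\<lambda>x y. {x, y} \<in> E)\<^sup>*\<^sup>* r v"
  shows "connected_graph V E"
proof -
  let ?R = "\<lambda>x y. {x, y} \<in> E"
  have "symp ?R" by (auto simp: symp_def insert_commute)
  then have "symp ?R\<^sup>*\<^sup>*" by (rule symp_rtranclp)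
  then show ?thesis
    using assms unfolding connected_graph_def by (meson rtranclp_trans sympD)
qed

lemma simple_graph_cycle_edges:
  assumes "distinct vs" "3 \<le> length vs"
  shows "simple_graph (set vs) (cycle_edges vs)"
proof -
  have "\<exists>u v. u \<in> set vs \<and> v \<in> set vs \<and> u \<noteq> v \<and> cyc_edge vs i = {u, v}" if "i < length vs" for i
  proof (intro exI conjI)
    have "vs \<noteq> []" using assms by auto
    then show "vs ! i \<noteq> vs ! ((i + 1) mod length vs)"
      using assms that by (auto simp: nth_eq_iff_index_eq Suc_mod_eq)
    show "vs ! ((i + 1) mod length vs) \<in> set vs"
      using that by (intro nth_mem mod_less_divisor) auto
  qed (use that in auto)
  then show ?thesis by (auto simp: simple_graph_def cycle_edges_image)
qed

lemma connected_graph_cycle_edges: "connected_graph (set vs) (cycle_edges vs)"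
proof (rule connected_graph_root)
  let ?R = "\<lambda>x y. {x, y} \<in> cycle_edges vs"
  have "?R\<^sup>*\<^sup>* (vs ! 0) (vs ! i)" if "i < length vs" for i
    using that
  proof (induction i)
    case (Suc i)
    have "cyc_edge vs i \<in> cycle_edges vs"
      using Suc.prems unfolding cycle_edges_image by (intro imageI) simp
    then have "?R (vs ! i) (vs ! Suc i)" using Suc.prems by simp
    then show ?case using Suc by (meson Suc_lessD rtranclp.rtrancl_into_rtrancl)
  qed simp
  then show "?R\<^sup>*\<^sup>* (vs ! 0) v" if "v \<in> set vs" for v
    using that by (auto simp: in_set_conv_nth)
qed

text \<open>A cycle inside has degree 2 at each of its vertices, as the whole graph does; so it is
  saturated and equals the whole.\<close>

lemma unicyclic_cycle_edges:
  assumes "distinct vs" "3 \<le> length vs"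
  shows "unicyclic (set vs) (cycle_edges vs)"
proof -
  have "D = cycle_edges vs" if D: "D \<subseteq> cycle_edges vs" "is_cycle D" for D
  proof (rule saturated_subgraph_eq(1)[OF simple_graph_cycle_edges[OF assms]
        connected_graph_cycle_edges D(1)])
    show "D \<noteq> {}" using is_cycle_edgeE[OF D(2)] by blast
    show "deg (cycle_edges vs) v \<le> deg D v" if "v \<in> \<Union>D" for v
    proof -
      have "v \<in> set vs" using that D(1) Union_cycle_edges[of vs] by blast
      then show ?thesis using is_cycle_deg[OF D(2) that] deg_cycle_edges[OF assms] by simp
    qed
  qed
  moreover have "is_cycle (cycle_edges vs)" using assms by (auto simp: is_cycle_def)
  ultimately show ?thesis
    using simple_graph_cycle_edges[OF assms] connected_graph_cycle_edges
    unfolding unicyclic_def by blast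
qed

text \<open>The new vertex has degree 1 while cycle vertices have degree 2, so no cycle uses the new
  edge.\<close>

lemma unicyclic_add_pendant:
  assumes uni: "unicyclic V E" and "u \<in> V" "x \<notin> V"
  shows "unicyclic (insert x V) (insert {u, x} E)"
  unfolding unicyclic_def
proof (intro conjI)
  note E = unicyclicD[OF uni]
  let ?E = "insert {u, x} E"
  show "simple_graph (insert x V) ?E"
    using E(1) assms(2,3) unfolding simple_graph_def by (auto; blast)
  show "connected_graph (insert x V) ?E"
  proof (rule connected_graph_root)
    fix v assume "v \<in> insert x V"
    then consider "v = x" | "v \<in> V" by blast
    then show "(\<lambda>x y. {x, y} \<in> ?E)\<^sup>*\<^sup>* u v"
    proof cases
      case 2
      then have "(\<lambda>x y. {x, y} \<in> E)\<^sup>*\<^sup>* u v"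
        using E(2) assms(2) by (simp add: connected_graph_def)
      then show ?thesis by (rule rtranclp_mono[THEN predicate2D, rotated]) auto
    qed auto
  qed
  have "D \<subseteq> E" if D: "D \<subseteq> ?E" "is_cycle D" for D
  proof -
    have "{u, x} \<notin> D"
    proof
      assume e: "{u, x} \<in> D"
      have "x \<notin> \<Union>E" using simple_graph_Union_edges[OF E(1)] assms(3) by blast
      then have "{e \<in> D. x \<in> e} \<subseteq> {{u, x}}" using D(1) by blast
      then have "deg D x \<le> 1"
        unfolding deg_def using card_mono[of "{{u, x}}"] by fastforce
      moreover have "deg D x = 2" using e by (intro is_cycle_deg[OF D(2)]) blast
      ultimately show False by simp
    qed
    then show ?thesis using D(1) by blast
  qed
  moreover have "\<exists>!C. C \<subseteq> E \<and> is_cycle C" using uni by (simp add: unicyclic_def)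
  ultimately show "\<exists>!C. C \<subseteq> ?E \<and> is_cycle C" by (metis subset_insertI2)
qed

text \<open>The path is built from the cycle outwards, each new vertex being pendant at the current
  free end.\<close>

lemma unicyclic_lollipop:
  assumes "distinct (vs @ ws)" "3 \<le> length vs"
  shows "unicyclic (set (vs @ ws)) (lollipop vs ws)"
  using assms
proof (induction ws rule: rev_induct)
  case Nil
  then show ?case using unicyclic_cycle_edges[of vs] by (simp add: lollipop_def)
next
  case (snoc x ws)
  have "vs \<noteq> []" using snoc.prems by auto
  then have "last (hd vs # ws) \<in> set (vs @ ws)" by auto
  moreover have "x \<notin> set (vs @ ws)" using snoc.prems by auto
  ultimately have "unicyclic (insert x (set (vs @ ws))) (insert {last (hd vs # ws), x} (lollipop vs ws))"
    using snoc by (intro unicyclic_add_pendant) auto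
  moreover have "lollipop vs (ws @ [x]) = insert {last (hd vs # ws), x} (lollipop vs ws)"
    using path_edges_snoc[of "hd vs # ws" x] by (simp add: lollipop_def)
  ultimately show ?case by simp
qed

subsection \<open>The index of the extremal graphs\<close>

lemma chi_cycle_edges:
  assumes "distinct vs" "3 \<le> length vs"
  shows "chi \<alpha> (cycle_edges vs) = real (length vs) * 4 powr \<alpha>"
proof -
  have "(\<Sum>v\<in>e. deg (cycle_edges vs) v) = 4" if "e \<in> cycle_edges vs" for e
  proof -
    obtain u v where "u \<in> set vs" "v \<in> set vs" "u \<noteq> v" "e = {u, v}"
      using simple_graph_cycle_edges[OF assms] \<open>e \<in> cycle_edges vs\<close> by (auto simp: simple_graph_def)
    then show ?thesis using deg_cycle_edges[OF assms] by simp
  qed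
  then have "chi \<alpha> (cycle_edges vs) = (\<Sum>e\<in>cycle_edges vs. 4 powr \<alpha>)"
    unfolding chi_def by (intro sum.cong) auto
  then show ?thesis using assms by (simp add: card_cycle_edges)
qed

text \<open>Along the cycle and along a path with at least two edges, only the first and the last
  index carry an exceptional degree sum.\<close>

lemma sum_lessThan_ends:
  fixes g :: "nat \<Rightarrow> 'a :: comm_monoid_add"
  assumes "2 \<le> l"
  shows "sum g {..<l} = g 0 + g (l - 1) + sum g {1..<l - 1}"
proof -
  have "{..<l} = insert 0 (insert (l - 1) {1..<l - 1})" using assms by auto
  then show ?thesis using assms by (simp add: add.assoc)
qed

text \<open>The two cycle edges at the head have degree sum 5. A single path edge has 3 + 1 = 4; a
  longer path starts with 3 + 2 and ends with 2 + 1. All other edges have 4.\<close>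

lemma chi_lollipop:
  assumes "distinct (vs @ ws)" "3 \<le> length vs"
  shows "length ws = 1 \<Longrightarrow> chi \<alpha> (lollipop vs ws) = real (length vs - 1) * 4 powr \<alpha> + 2 * 5 powr \<alpha>"
    and "2 \<le> length ws \<Longrightarrow> chi \<alpha> (lollipop vs ws) =
      real (length vs + length ws - 4) * 4 powr \<alpha> + 3 * 5 powr \<alpha> + 3 powr \<alpha>"
proof -
  let ?L = "lollipop vs ws" and ?l = "length vs" and ?m = "length ws" and ?p = "hd vs # ws"
  let ?f = "\<lambda>e. real (\<Sum>v\<in>e. deg ?L v) powr \<alpha>"
  have ne: "vs \<noteq> []" using assms by auto
  have dv: "distinct vs" and dp: "distinct ?p" using assms ne by (cases vs; auto)+
  note d = deg_lollipop[OF assms]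
  have "chi \<alpha> ?L = sum ?f (cycle_edges vs) + sum ?f (path_edges ?p)"
    unfolding chi_def using cycle_path_disjoint[OF assms(1)]
    by (subst (1) lollipop_def) (simp add: sum.union_disjoint)
  also have "sum ?f (cycle_edges vs) = (\<Sum>i<?l. ?f (cyc_edge vs i))"
    unfolding cycle_edges_image using inj_on_cyc_edge[OF dv assms(2)] by (simp add: sum.reindex)
  also have "sum ?f (path_edges ?p) = (\<Sum>i<?m. ?f (path_edge ?p i))"
    unfolding path_edges_image using inj_on_path_edge[OF dp] by (simp add: sum.reindex)
  finally have chi: "chi \<alpha> ?L = (\<Sum>i<?l. ?f (cyc_edge vs i)) + (\<Sum>i<?m. ?f (path_edge ?p i))" .
  have dvs: "deg ?L (vs ! i) = (if i = 0 \<and> ws \<noteq> [] then 3 else 2)" if "i < ?l" for i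
    using d(1)[of "vs ! i"] that ne dv by (auto simp: hd_conv_nth nth_eq_iff_index_eq)
  have c: "?f (cyc_edge vs i) = (if i = 0 \<or> i = ?l - 1 then 5 powr \<alpha> else 4 powr \<alpha>)"
    if "i < ?l" "ws \<noteq> []" for i
  proof -
    have "vs ! i \<noteq> vs ! ((i + 1) mod ?l)"
      using assms that ne dv by (auto simp: nth_eq_iff_index_eq Suc_mod_eq)
    moreover have "(i + 1) mod ?l < ?l" using that by (intro mod_less_divisor) auto
    ultimately have "(\<Sum>v\<in>cyc_edge vs i. deg ?L v) = (if i = 0 \<or> i = ?l - 1 then 5 else 4)"
      using that assms dvs[of i] dvs[of "(i + 1) mod ?l"] by (auto simp: Suc_mod_eq)
    then show ?thesis by simp
  qed
  have "(\<Sum>i<?l. ?f (cyc_edge vs i)) = 2 * 5 powr \<alpha> + real (?l - 2) * 4 powr \<alpha>" if "ws \<noteq> []"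
  proof -
    have "sum (\<lambda>i. ?f (cyc_edge vs i)) {1..<?l - 1} = (\<Sum>i\<in>{1..<?l - 1}. 4 powr \<alpha>)"
      using that by (intro sum.cong refl) (subst c; auto)
    then show ?thesis
      using assms ne that c[of 0] c[of "?l - 1"] by (subst sum_lessThan_ends) (auto simp: numeral_2_eq_2)
  qed
  note cycle_part = this
  have dws: "deg ?L (?p ! i) = (if i = 0 then 3 else if i = ?m then 1 else 2)"
    if "i \<le> ?m" "ws \<noteq> []" for i
    using d(1)[of "hd vs"] d(2)[of "i - 1"] that ne by (cases i) auto
  have p: "(\<Sum>v\<in>path_edge ?p i. deg ?L v) = deg ?L (?p ! i) + deg ?L (?p ! (i + 1))"
    if "i < ?m" for i
    using that nth_eq_iff_index_eq[OF dp, of i "i + 1"] by simp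
  show "chi \<alpha> ?L = real (?l - 1) * 4 powr \<alpha> + 2 * 5 powr \<alpha>" if m: "?m = 1"
  proof -
    have "ws \<noteq> []" using m by auto
    moreover have "?f (path_edge ?p 0) = 4 powr \<alpha>"
      using m p[of 0] dws[of 0] dws[of 1] \<open>ws \<noteq> []\<close> by simp
    moreover have "{..<?m} = {0}" using m by auto
    ultimately have "chi \<alpha> ?L = 2 * 5 powr \<alpha> + real (?l - 2) * 4 powr \<alpha> + 4 powr \<alpha>"
      unfolding chi using cycle_part by simp
    moreover have "real (?l - 1) = real (?l - 2) + 1" using assms(2) by linarith
    ultimately show ?thesis by (simp add: algebra_simps)
  qed
  show "chi \<alpha> ?L = real (?l + ?m - 4) * 4 powr \<alpha> + 3 * 5 powr \<alpha> + 3 powr \<alpha>" if m: "2 \<le> ?m"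
  proof -
    have ws: "ws \<noteq> []" "?m - 1 \<noteq> ?m" using m by auto
    have mid: "?f (path_edge ?p i) = 4 powr \<alpha>" if "i \<in> {1..<?m - 1}" for i
    proof -
      have "i < ?m" "i \<noteq> 0" "i + 1 \<noteq> ?m" using that by auto
      then show ?thesis using p[of i] dws[of i] dws[of "i + 1"] ws by simp
    qed
    have "?f (path_edge ?p 0) = 5 powr \<alpha>"
      using m p[of 0] dws[of 0] dws[of 1] ws by simp
    moreover have "?f (path_edge ?p (?m - 1)) = 3 powr \<alpha>"
      using m p[of "?m - 1"] dws[of "?m - 1"] dws[of ?m] ws by simp
    moreover have "sum (\<lambda>i. ?f (path_edge ?p i)) {1..<?m - 1} = (\<Sum>i\<in>{1..<?m - 1}. 4 powr \<alpha>)"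
      by (rule sum.cong[OF refl]) (rule mid)
    ultimately have "(\<Sum>i<?m. ?f (path_edge ?p i)) = 5 powr \<alpha> + 3 powr \<alpha> + real (?m - 2) * 4 powr \<alpha>"
      by (subst sum_lessThan_ends[OF m]) (simp add: numeral_2_eq_2)
    then have "chi \<alpha> ?L = 2 * 5 powr \<alpha> + real (?l - 2) * 4 powr \<alpha>
        + (5 powr \<alpha> + 3 powr \<alpha> + real (?m - 2) * 4 powr \<alpha>)"
      unfolding chi using cycle_part[OF ws(1)] by simp
    moreover have "real (?l + ?m - 4) = real (?l - 2) + real (?m - 2)" using assms(2) m by linarith
    ultimately show ?thesis by (simp add: algebra_simps)
  qed
qed

subsection \<open>The upper bounds\<close>

text \<open>These are the edges on which \<open>edge_bound\<close> subtracts the loss.\<close>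

definition branch_edges :: "'a set set \<Rightarrow> 'a set set" where
  "branch_edges E = {e \<in> E. \<exists>v\<in>e. 3 \<le> deg E v}"

lemma deg_pos: "finite E \<Longrightarrow> e \<in> E \<Longrightarrow> v \<in> e \<Longrightarrow> 1 \<le> deg E v"
  unfolding deg_def by (auto simp: Suc_le_eq card_gt_0_iff)

text \<open>Such an edge would be a saturated subgraph, hence the whole graph on only two vertices.
  This rules out the degree pair (1, 1).\<close>

lemma no_isolated_edge:
  assumes "simple_graph V E" "connected_graph V E" "3 \<le> card V" "{u, v} \<in> E"
  shows "\<not> (deg E u = 1 \<and> deg E v = 1)"
proof
  assume one: "deg E u = 1 \<and> deg E v = 1"
  have "\<Union>{{u, v}} = V"
  proof (rule saturated_subgraph_eq(2)[OF assms(1,2)])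
    show "deg E x \<le> deg {{u, v}} x" if "x \<in> \<Union>{{u, v}}" for x
      using that one deg_pos[of "{{u, v}}" "{u, v}" x] by auto
  qed (use assms in auto)
  then have "card V \<le> card {u, v}" by simp
  also have "\<dots> \<le> 2" by (simp add: card_insert_if)
  finally show False using assms(3) by simp
qed

text \<open>The edge inequality is summed over all edges. Equality of the sums forces equality on
  every edge, which pins down the degrees wherever an end branches.\<close>

lemma chi_le:
  fixes \<alpha> :: real
  assumes \<alpha>: "-1 \<le> \<alpha>" "\<alpha> < 0" and uni: "unicyclic V E" and V: "3 \<le> card V"
  defines "bound \<equiv> real (card V) * 4 powr \<alpha> - real (card (branch_edges E)) * branch_loss \<alpha>"
  shows "chi \<alpha> E \<le> bound"
    and "chi \<alpha> E = bound \<Longrightarrow> {u, v} \<in> E \<Longrightarrow> 3 \<le> deg E u \<Longrightarrow> deg E u = 3 \<and> deg E v = 2"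
proof -
  note E = unicyclicD[OF uni]
  let ?b = "vertex_coeff \<alpha>" and ?s = "branch_loss \<alpha>" and ?K = "branch_edges E"
  let ?f = "\<lambda>e. real (\<Sum>v\<in>e. deg E v) powr \<alpha>"
  let ?B = "\<lambda>e. (4 powr \<alpha> - ?b) + (\<Sum>v\<in>e. ?b / real (deg E v)) - (if e \<in> ?K then ?s else 0)"
  have fB: "?f e = real (deg E u + deg E v) powr \<alpha>" "?B e = edge_bound \<alpha> (deg E u) (deg E v)"
    if "e \<in> E" "e = {u, v}" for e u v
    using that simple_graph_edge(1)[OF E(1)] by (auto simp: edge_bound_def branch_edges_def algebra_simps)
  have ends: "1 \<le> deg E u" "1 \<le> deg E v" "(deg E u, deg E v) \<noteq> (1, 1)" if "{u, v} \<in> E" for u v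
    using that deg_pos[OF E(4)] no_isolated_edge[OF E(1,2) V that] by auto
  have le: "?f e \<le> ?B e" if "e \<in> E" for e
  proof -
    obtain u v where e: "e = {u, v}" using E(1) \<open>e \<in> E\<close> by (auto simp: simple_graph_def)
    then show ?thesis
      unfolding fB[OF that e] using ends[of u v] that powr_sum_eq_edge_bound(1)[OF \<alpha>] by simp
  qed
  have "(\<Sum>e\<in>E. \<Sum>v\<in>e. ?b / real (deg E v)) = (\<Sum>v\<in>V. real (deg E v) * (?b / real (deg E v)))"
    by (rule sum_over_edge_ends[OF E(1)])
  \<comment> \<open>A term is \<open>?b\<close> for positive degree; for degree 0 the division by
    zero makes it 0.\<close>
  also have "\<dots> \<le> (\<Sum>v\<in>V. ?b)"
    using vertex_coeff_pos[OF \<alpha>(2)] by (intro sum_mono) auto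
  finally have vertices: "(\<Sum>e\<in>E. \<Sum>v\<in>e. ?b / real (deg E v)) \<le> real (card V) * ?b" by simp
  have "(\<Sum>e\<in>E. if e \<in> ?K then ?s else 0) = real (card ?K) * ?s"
    using E(4) by (simp add: branch_edges_def flip: sum.inter_filter)
  then have "(\<Sum>e\<in>E. ?B e) = real (card E) * (4 powr \<alpha> - ?b)
      + (\<Sum>e\<in>E. \<Sum>v\<in>e. ?b / real (deg E v)) - real (card ?K) * ?s"
    by (simp add: sum.distrib sum_subtractf)
  \<comment> \<open>There are at most \<open>card V\<close> edges, and the factor
    \<open>4 powr \<alpha> - ?b\<close> is nonnegative.\<close>
  also have "\<dots> \<le> real (card V) * (4 powr \<alpha> - ?b) + real (card V) * ?b - real (card ?K) * ?s"
    using vertices unicyclic_card_edges[OF uni] vertex_coeff_le[OF \<alpha>(1)]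
    by (intro diff_right_mono add_mono mult_right_mono) auto
  finally have B: "(\<Sum>e\<in>E. ?B e) \<le> bound" by (simp add: bound_def algebra_simps)
  have "chi \<alpha> E \<le> (\<Sum>e\<in>E. ?B e)" unfolding chi_def by (rule sum_mono) (rule le)
  then show "chi \<alpha> E \<le> bound" using B by simp
  show "deg E u = 3 \<and> deg E v = 2"
    if eq: "chi \<alpha> E = bound" and uv: "{u, v} \<in> E" and u: "3 \<le> deg E u"
  proof -
    have "(\<Sum>e\<in>E. ?f e) = (\<Sum>e\<in>E. ?B e)"
      using eq B \<open>chi \<alpha> E \<le> (\<Sum>e\<in>E. ?B e)\<close> by (simp add: chi_def)
    then have "?f {u, v} = ?B {u, v}" using le uv E(4) by (rule sum_mono_inv)
    then have "{deg E u, deg E v} = {2, 3}"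
      unfolding fB[OF uv refl] using powr_sum_eq_edge_bound(2)[OF \<alpha> ends[OF uv]] u by blast
    then show ?thesis using u by (auto simp: doubleton_eq_iff)
  qed
qed

lemma edges_at_subset_branch_edges: "3 \<le> deg E w \<Longrightarrow> {e \<in> E. w \<in> e} \<subseteq> branch_edges E"
  by (auto simp: branch_edges_def)

lemma card_branch_edges_ge:
  assumes "finite E" "3 \<le> deg E w"
  shows "3 \<le> card (branch_edges E)"
proof -
  have "finite (branch_edges E)" using assms(1) by (simp add: branch_edges_def)
  then have "deg E w \<le> card (branch_edges E)"
    unfolding deg_def using edges_at_subset_branch_edges[OF assms(2)] by (intro card_mono)
  then show ?thesis using assms(2) by simp
qed

lemma second_value_eq:
  "real n * 4 powr \<alpha> - 3 * branch_loss \<alpha> = (real n - 4) * 4 powr \<alpha> + 3 * 5 powr \<alpha> + 3 powr \<alpha>"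
  by (simp add: branch_loss_def field_simps)

text \<open>A branching vertex supplies three branch edges. At equality there are no more, and each
  joins degrees 3 and 2; a second branching vertex would be non-adjacent to the first and bring
  three further ones.\<close>

lemma chi_not_cycle_le:
  assumes \<alpha>: "-1 \<le> \<alpha>" "\<alpha> < 0" and uni: "unicyclic V E" and V: "3 \<le> card V"
    and "\<not> is_cycle_graph V E"
  shows "chi \<alpha> E \<le> real (card V) * 4 powr \<alpha> - 3 * branch_loss \<alpha>"
    and "chi \<alpha> E = real (card V) * 4 powr \<alpha> - 3 * branch_loss \<alpha> \<Longrightarrow>
      \<exists>l\<ge>3. cycle_with_path V E l"
proof -
  note E = unicyclicD[OF uni]
  let ?K = "branch_edges E"
  have finK: "finite ?K" using E(4) by (simp add: branch_edges_def)
  obtain w where w: "w \<in> V" "3 \<le> deg E w"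
    using max_deg_2_imp_cycle_graph[OF uni] assms(5) by fastforce
  have s: "0 < branch_loss \<alpha>" using branch_loss_pos[OF \<alpha>] .
  have K: "3 \<le> card ?K" using card_branch_edges_ge[OF E(4) w(2)] .
  then have "3 * branch_loss \<alpha> \<le> real (card ?K) * branch_loss \<alpha>"
    using s by (intro mult_right_mono) auto
  with chi_le(1)[OF \<alpha> uni V]
  show "chi \<alpha> E \<le> real (card V) * 4 powr \<alpha> - 3 * branch_loss \<alpha>" by simp
  assume eq: "chi \<alpha> E = real (card V) * 4 powr \<alpha> - 3 * branch_loss \<alpha>"
  then have "real (card ?K) * branch_loss \<alpha> \<le> 3 * branch_loss \<alpha>"
    using chi_le(1)[OF \<alpha> uni V] by simp
  then have K3: "card ?K = 3" using s K by simp
  then have tight: "deg E u = 3 \<and> deg E v = 2" if "{u, v} \<in> E" "3 \<le> deg E u" for u v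
    using chi_le(2)[OF \<alpha> uni V] eq that by simp
  have "{e \<in> E. w \<in> e} \<noteq> {}" using w(2) unfolding deg_def by (metis card.empty not_numeral_le_zero)
  then obtain e u where "e \<in> E" "e = {w, u}"
    using simple_graph_edgeE[OF E(1)] by (metis (mono_tags, lifting) empty_Collect_eq)
  then have w3: "deg E w = 3" using tight w(2) by blast
  have "deg E v \<le> 2" if v: "v \<in> V" "v \<noteq> w" for v
  proof (rule ccontr)
    assume "\<not> deg E v \<le> 2"
    then have v3: "3 \<le> deg E v" by simp
    \<comment> \<open>Tightness gives every neighbour of \<open>w\<close> degree 2.\<close>
    have "{w, v} \<notin> E" using tight[of w v] w(2) v3 by auto
    then have "{e \<in> E. w \<in> e} \<inter> {e \<in> E. v \<in> e} = {}"
      using simple_graph_edgeE[OF E(1)] v(2)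
      by (smt (verit) disjoint_iff insertE mem_Collect_eq singletonD)
    then have "deg E w + deg E v = card ({e \<in> E. w \<in> e} \<union> {e \<in> E. v \<in> e})"
      unfolding deg_def using E(4) by (simp add: card_Un_disjoint)
    also have "\<dots> \<le> card ?K"
      using edges_at_subset_branch_edges[OF w(2)] edges_at_subset_branch_edges[OF v3] finK
      by (intro card_mono) auto
    finally show False using w(2) v3 K3 by simp
  qed
  then show "\<exists>l\<ge>3. cycle_with_path V E l"
    using one_branching_vertex_imp_lollipop[OF uni w(1) w3] by blast
qed

text \<open>On four vertices the general bound is not attained, so edges are counted directly: two
  vertices of degree 3 share at most one edge and would need at least five edges, but there are at
  most four.\<close>

lemma not_cycle_order_4:
  assumes uni: "unicyclic V E" and V: "card V = 4" and "\<not> is_cycle_graph V E"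
  shows "\<exists>l\<ge>3. cycle_with_path V E l"
proof -
  note E = unicyclicD[OF uni]
  obtain w where w: "w \<in> V" "3 \<le> deg E w"
    using max_deg_2_imp_cycle_graph[OF uni] assms(3) by fastforce
  have "{u. {w, u} \<in> E} \<subseteq> V - {w}"
    using simple_graph_edge[OF E(1)] by auto
  then have "card {u. {w, u} \<in> E} \<le> card (V - {w})" using E(3) by (intro card_mono) auto
  then have w3: "deg E w = 3"
    using card_neighbours[OF E(1), of w] w V by simp
  have "deg E v \<le> 2" if v: "v \<in> V" "v \<noteq> w" for v
  proof (rule ccontr)
    assume v3: "\<not> deg E v \<le> 2"
    let ?W = "{e \<in> E. w \<in> e}" and ?U = "{e \<in> E. v \<in> e}"
    have fin: "finite ?W" "finite ?U" using E(4) by auto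
    have "?W \<inter> ?U \<subseteq> {{w, v}}"
    proof
      fix e assume e: "e \<in> ?W \<inter> ?U"
      then obtain x where "e = {w, x}" using simple_graph_edgeE[OF E(1), of e w] by blast
      then show "e \<in> {{w, v}}" using e v(2) by auto
    qed
    then have "card (?W \<inter> ?U) \<le> card {{w, v}}" by (intro card_mono) auto
    moreover have "deg E w + deg E v = card (?W \<union> ?U) + card (?W \<inter> ?U)"
      unfolding deg_def by (rule card_Un_Int[OF fin])
    moreover have "card (?W \<union> ?U) \<le> card E" using E(4) by (intro card_mono) auto
    ultimately show False using unicyclic_card_edges[OF uni] V w3 v3 by simp
  qed
  then show ?thesis
    using one_branching_vertex_imp_lollipop[OF uni w(1) w3] by blast
qed

section \<open>Values of the extremal graphs and the final comparison\<close>

lemma chi_cycle_graph: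
  assumes "is_cycle_graph V E"
  shows "chi \<alpha> E = real (card V) * 4 powr \<alpha>"
  using assms chi_cycle_edges by (metis distinct_card is_cycle_graph_def)

lemma cycle_with_path_lollipopE:
  assumes "cycle_with_path V E l"
  obtains vs ws where "distinct (vs @ ws)" "3 \<le> length vs" "length vs = l" "E = lollipop vs ws"
    "set (vs @ ws) = V" "card V = l + length ws" "ws \<noteq> []"
proof -
  obtain vs ws where *: "distinct (vs @ ws)" "set (vs @ ws) = V" "length vs = l" "l \<ge> 3"
    "ws \<noteq> []" "E = cycle_edges vs \<union> path_edges (hd vs # ws)"
    using assms unfolding cycle_with_path_def by blast
  moreover have "card V = l + length ws"
    using distinct_card[OF *(1)] *(2,3) by simp
  ultimately show ?thesis
    using that[of vs ws] by (simp add: lollipop_def)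
qed

lemma chi_cycle_with_path:
  assumes "cycle_with_path V E l"
  shows "l + 1 = card V \<Longrightarrow> chi \<alpha> E = (real (card V) - 2) * 4 powr \<alpha> + 2 * 5 powr \<alpha>"
    and "l + 2 \<le> card V \<Longrightarrow> chi \<alpha> E = real (card V) * 4 powr \<alpha> - 3 * branch_loss \<alpha>"
proof -
  obtain vs ws where *: "distinct (vs @ ws)" "3 \<le> length vs" "length vs = l" "E = lollipop vs ws"
    "card V = l + length ws"
    using assms by (rule cycle_with_path_lollipopE)
  show "chi \<alpha> E = (real (card V) - 2) * 4 powr \<alpha> + 2 * 5 powr \<alpha>" if "l + 1 = card V"
    using chi_lollipop(1)[OF *(1,2), of \<alpha>] * that by (simp add: of_nat_diff)
  show "chi \<alpha> E = real (card V) * 4 powr \<alpha> - 3 * branch_loss \<alpha>" if "l + 2 \<le> card V"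
    unfolding second_value_eq using chi_lollipop(2)[OF *(1,2), of \<alpha>] * that
    by (simp add: of_nat_diff)
qed

lemma ex_cycle_with_path:
  assumes "4 \<le> n"
  shows "\<exists>E :: nat set set. unicyclic {0..<n} E \<and> cycle_with_path {0..<n} E 3"
proof -
  \<comment> \<open>A triangle with all remaining vertices strung on a path at 0: for
    \<open>n = 4\<close> this is the triangle with a pendant vertex, for larger \<open>n\<close> the
    path has at least two vertices.\<close>
  let ?vs = "[0..<3]" and ?ws = "[3..<n]"
  have app: "?vs @ ?ws = [0..<n]" using assms upt_add_eq_append[of 0 3 "n - 3"] by simp
  have "unicyclic (set (?vs @ ?ws)) (lollipop ?vs ?ws)"
    by (rule unicyclic_lollipop) (unfold app, auto)
  moreover have "cycle_with_path (set (?vs @ ?ws)) (lollipop ?vs ?ws) 3"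
    unfolding cycle_with_path_def lollipop_def
    using assms by (intro exI[of _ ?vs] exI[of _ ?ws]) (unfold app, auto)
  ultimately show ?thesis unfolding app by auto
qed

theorem theorem3:
  fixes \<alpha> :: real and n :: nat
  assumes "-1 \<le> \<alpha>" and "\<alpha> < 0" and "n \<ge> 4"
  shows
   "(\<forall>E :: nat set set. unicyclic {0..<n} E \<longrightarrow>
        chi \<alpha> E \<le> real n * 4 powr \<alpha> \<and>
        (chi \<alpha> E = real n * 4 powr \<alpha> \<longleftrightarrow> is_cycle_graph {0..<n} E))
    \<and> (\<exists>E :: nat set set. unicyclic {0..<n} E \<and> is_cycle_graph {0..<n} E)
    \<and> (n = 4 \<longrightarrow>
        (\<forall>E :: nat set set. unicyclic {0..<n} E \<and> \<not> is_cycle_graph {0..<n} E \<longrightarrow>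
            chi \<alpha> E \<le> 2 * 4 powr \<alpha> + 2 * 5 powr \<alpha> \<and>
            (chi \<alpha> E = 2 * 4 powr \<alpha> + 2 * 5 powr \<alpha> \<longleftrightarrow> cycle_with_path {0..<n} E 3))
        \<and> (\<exists>E :: nat set set. unicyclic {0..<n} E \<and> cycle_with_path {0..<n} E 3))
    \<and> (n \<ge> 5 \<longrightarrow>
        (\<forall>E :: nat set set. unicyclic {0..<n} E \<and> \<not> is_cycle_graph {0..<n} E \<longrightarrow>
            chi \<alpha> E \<le> real (n - 4) * 4 powr \<alpha> + 3 * 5 powr \<alpha> + 3 powr \<alpha> \<and>
            (chi \<alpha> E = real (n - 4) * 4 powr \<alpha> + 3 * 5 powr \<alpha> + 3 powr \<alpha> \<longleftrightarrow>
               (\<exists>l. 3 \<le> l \<and> l \<le> n - 2 \<and> cycle_with_path {0..<n} E l)))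
        \<and> (\<exists>E :: nat set set. unicyclic {0..<n} E \<and> \<not> is_cycle_graph {0..<n} E \<and>
            chi \<alpha> E = real (n - 4) * 4 powr \<alpha> + 3 * 5 powr \<alpha> + 3 powr \<alpha>))"
proof (intro conjI impI allI)
  let ?V = "{0..<n}"
  let ?second = "real n * 4 powr \<alpha> - 3 * branch_loss \<alpha>"
  have card: "3 \<le> card ?V" using assms(3) by simp
  have s: "0 < branch_loss \<alpha>" using branch_loss_pos assms by blast
  have second: "real (n - 4) * 4 powr \<alpha> + 3 * 5 powr \<alpha> + 3 powr \<alpha> = ?second"
    using assms(3) by (simp add: second_value_eq of_nat_diff)
  have cycle: "chi \<alpha> E = real n * 4 powr \<alpha>" if "is_cycle_graph ?V E" for E :: "nat set set"
    using chi_cycle_graph[OF that] by simp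
  have not_cycle: "chi \<alpha> E \<le> ?second" "chi \<alpha> E = ?second \<Longrightarrow> \<exists>l\<ge>3. cycle_with_path ?V E l"
    if "unicyclic ?V E" "\<not> is_cycle_graph ?V E" for E :: "nat set set"
    using chi_not_cycle_le[OF assms(1,2) that(1) card that(2)] by simp_all
  have pendant: "chi \<alpha> E = (real n - 2) * 4 powr \<alpha> + 2 * 5 powr \<alpha>"
    if "cycle_with_path ?V E l" "l + 1 = n" for E :: "nat set set" and l
    using chi_cycle_with_path(1)[OF that(1)] that(2) by simp
  have long: "chi \<alpha> E = ?second" if "cycle_with_path ?V E l" "l + 2 \<le> n" for E :: "nat set set" and l
    using chi_cycle_with_path(2)[OF that(1)] that(2) by simp
  have less: "l < n" if "cycle_with_path ?V E l" for E :: "nat set set" and l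
    using that by (rule cycle_with_path_lollipopE) auto
  {
    fix E :: "nat set set" assume uni: "unicyclic ?V E"
    show "chi \<alpha> E \<le> real n * 4 powr \<alpha>"
      using cycle not_cycle(1)[OF uni] s by fastforce
    show "chi \<alpha> E = real n * 4 powr \<alpha> \<longleftrightarrow> is_cycle_graph ?V E"
      using cycle not_cycle(1)[OF uni] s by fastforce
  }
  show "\<exists>E :: nat set set. unicyclic ?V E \<and> is_cycle_graph ?V E"
  proof (intro exI conjI)
    show "unicyclic ?V (cycle_edges [0..<n])"
      using unicyclic_cycle_edges[of "[0..<n]"] assms(3) by simp
    show "is_cycle_graph ?V (cycle_edges [0..<n])"
      using assms(3) unfolding is_cycle_graph_def by (intro exI[of _ "[0..<n]"]) auto
  qed
  show "\<exists>E :: nat set set. unicyclic ?V E \<and> cycle_with_path ?V E 3"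
    using ex_cycle_with_path[OF assms(3)] .
  {
    fix E :: "nat set set"
    assume n4: "n = 4" and E: "unicyclic ?V E \<and> \<not> is_cycle_graph ?V E"
    then obtain l where l: "3 \<le> l" "cycle_with_path ?V E l"
      using not_cycle_order_4[of ?V E] by auto
    \<comment> \<open>The path takes at least one of the four vertices. Thus every competitor is the
      triangle with a pendant vertex and has the same value.\<close>
    then have "l = 3" using less[OF l(2)] n4 by simp
    then have "cycle_with_path ?V E 3" "chi \<alpha> E = 2 * 4 powr \<alpha> + 2 * 5 powr \<alpha>"
      using pendant[OF l(2)] l(2) n4 by simp_all
    then show "chi \<alpha> E \<le> 2 * 4 powr \<alpha> + 2 * 5 powr \<alpha>"
      "chi \<alpha> E = 2 * 4 powr \<alpha> + 2 * 5 powr \<alpha> \<longleftrightarrow> cycle_with_path ?V E 3"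
      by simp_all
  }
  {
    fix E :: "nat set set"
    assume n5: "n \<ge> 5" and E: "unicyclic ?V E \<and> \<not> is_cycle_graph ?V E"
    show "chi \<alpha> E \<le> real (n - 4) * 4 powr \<alpha> + 3 * 5 powr \<alpha> + 3 powr \<alpha>"
      unfolding second using not_cycle(1) E by blast
    show "chi \<alpha> E = real (n - 4) * 4 powr \<alpha> + 3 * 5 powr \<alpha> + 3 powr \<alpha> \<longleftrightarrow>
        (\<exists>l. 3 \<le> l \<and> l \<le> n - 2 \<and> cycle_with_path ?V E l)"
      unfolding second
    proof
      assume eq: "chi \<alpha> E = ?second"
      then obtain l where l: "3 \<le> l" "cycle_with_path ?V E l"
        using not_cycle(2) E by blast
      \<comment> \<open>A single pendant vertex falls short of the second value by
        \<open>3 powr \<alpha> + 5 powr \<alpha> - 2 * 4 powr \<alpha>\<close>, which is positive by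
        convexity.\<close>
      have "l + 1 \<noteq> n"
      proof
        assume "l + 1 = n"
        then have "?second = (real n - 2) * 4 powr \<alpha> + 2 * 5 powr \<alpha>"
          using pendant[OF l(2)] eq by simp
        then show False
          using powr_345_convex[OF assms(2)] by (simp add: branch_loss_def field_simps)
      qed
      then show "\<exists>l. 3 \<le> l \<and> l \<le> n - 2 \<and> cycle_with_path ?V E l"
        using l less[OF l(2)] by (intro exI[of _ l]) auto
    next
      assume "\<exists>l. 3 \<le> l \<and> l \<le> n - 2 \<and> cycle_with_path ?V E l"
      then show "chi \<alpha> E = ?second" using long n5 by fastforce
    qed
  }
  assume n5: "n \<ge> 5"
  obtain E :: "nat set set" where E: "unicyclic ?V E" "cycle_with_path ?V E 3"
    using ex_cycle_with_path[OF assms(3)] by blast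
  have "chi \<alpha> E = ?second" using long[OF E(2)] n5 by simp
  \<comment> \<open>A cycle would have the strictly larger maximum value.\<close>
  moreover from this have "\<not> is_cycle_graph ?V E" using cycle[of E] s by auto
  ultimately show "\<exists>E :: nat set set. unicyclic ?V E \<and> \<not> is_cycle_graph ?V E \<and>
      chi \<alpha> E = real (n - 4) * 4 powr \<alpha> + 3 * 5 powr \<alpha> + 3 powr \<alpha>"
    unfolding second using E(1) by blast
qed

end
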